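(* Let $\mathcal{P}$ be a well-formed integer program and let $\alpha\in\mathcal{P}$. Let $\alpha'$ be the rule with the same left-hand side, cost and guard as $\alpha$ but with $\mathrm{rhs}(\alpha')\subset\mathrm{rhs}(\alpha)$ (a proper sub-multiset), and let $\mathcal{P}'=\mathcal{P}\cup\{\alpha'\}$. Then $\mathcal{P}'$ is well formed and the processor mapping $\mathcal{P}$ to $\mathcal{P}'$ is sound.
   Context: Fix a finite set $\Sigma$ of function symbols of common arity $k$ containing a start symbol $f_0$, and variables ranging over $\mathbb{Z}$. A rule has the form $f(\vec x)\xrightarrow{c}T\ [\varphi]$ where $\vec x$ is a fixed vector of pairwise different program variables, $f\in\Sigma$, $c$ an arithmetic expression (cost), $T$ a finite multiset of terms $g(t_1,\dots,t_k)$ ($g\in\Sigma$, $t_i$ arithmetic expressions), $\varphi$ a finite conjunction of inequations between arithmetic expressions (guard). An integer program is a finite set of rules in which $f_0$ does not occur on right-hand sides. An integer substitution maps variables of its domain to integers; $\sigma\models\alpha$ means all variables of $\alpha$ are in $\mathrm{dom}(\sigma)$ and $\sigma$ models the guard. A configuration is a finite multiset of terms $f(n_1,\dots,n_k)$, $n_i\in\mathbb{Z}$. $S\xrightarrow{k}_{\mathcal{P}}T$ if there are $s\in S$, a rule $f(\vec x)\xrightarrow{c}Q\ [\varphi]$ in $\mathcal{P}$ and an integer substitution $\sigma$ covering the rule's variables with $f(\vec x)\sigma=s$, $\sigma\models\varphi$, $c\sigma=k$, $T=(S\setminus\{s\})\cup Q\sigma$ (multisets, equality modulo arithmetic); costs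 of sequences are summed. $\mathrm{dh}_{\mathcal{P}}(S)=\sup\{k\mid S\xrightarrow{k}{}^{*}_{\mathcal{P}}T\}$, $\mathrm{rc}_{\mathcal{P}}(n)=\sup\{\mathrm{dh}_{\mathcal{P}}(f_0(\vec n))\mid\vec n\in\mathbb{Z}^k,\sum_i|n_i|\leq n\}$. A rule $\alpha$ is well formed if $t_i\sigma\in\mathbb{Z}$ for all $f(t_1,\dots,t_k)\in\mathrm{rhs}(\alpha)$, all $i$ and all integer $\sigma\models\alpha$; a program is well formed if all its rules are. A processor is a partial function on integer programs; it is sound if $\mathrm{rc}_{\mathcal{P}}(n)\geq\mathrm{rc}_{\mathrm{proc}(\mathcal{P})}(n)$ for all $n\in\mathbb{N}$ and all $\mathcal{P}$ where it is defined. *)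

theory Defs
  imports Complex_Main "HOL-Library.Multiset" "HOL-Library.Extended_Real"
begin

datatype (vars: 'v) aexp =
    Var 'v
  | Num real
  | Add "'v aexp" "'v aexp"
  | Sub "'v aexp" "'v aexp"
  | Mul "'v aexp" "'v aexp"
  | Div "'v aexp" "'v aexp"
  | Pow "'v aexp" "'v aexp"

datatype (ineq_vars: 'v) ineq =
    Less "'v aexp" "'v aexp"
  | LessEq "'v aexp" "'v aexp"
  | Greater "'v aexp" "'v aexp"
  | GreaterEq "'v aexp" "'v aexp"

text \<open>Terms consist of a function symbol and its list of arguments.  The argument vector of
  every left-hand side is the globally fixed list of program variables (called \<open>xs\<close> below),
  so a rule only stores the root symbol of its left-hand side.\<close>

type_synonym ('f, 'v) trm = "'f \<times> 'v aexp list"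

datatype ('f, 'v) rule =
  Rule (lhs: 'f) (cost: "'v aexp") (rhs: "('f, 'v) trm multiset") (guard: "'v ineq list")

type_synonym ('f, 'v) program = "('f, 'v) rule set"

type_synonym 'v subst = "'v \<Rightarrow> int option"

type_synonym 'f config = "('f \<times> int list) multiset"

definition rule_vars :: "'v list \<Rightarrow> ('f, 'v) rule \<Rightarrow> 'v set" where
  "rule_vars xs \<alpha> = set xs \<union> vars (cost \<alpha>)
     \<union> (\<Union>(g, ts)\<in>set_mset (rhs \<alpha>). \<Union>t\<in>set ts. vars t)
     \<union> (\<Union>q\<in>set (guard \<alpha>). ineq_vars q)"

text \<open>Evaluation is partial: \<open>None\<close> results from variables outside the domain of the
  substitution, from division by zero, and from undefined powers.  Intermediate values are real,
  since subexpressions may be non-integral even if all variables are integers.\<close>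

definition lift_opt :: "('a \<Rightarrow> 'a \<Rightarrow> 'a option) \<Rightarrow> 'a option \<Rightarrow> 'a option \<Rightarrow> 'a option" where
  "lift_opt h a b = Option.bind a (\<lambda>x. Option.bind b (h x))"

definition power_opt :: "real \<Rightarrow> real \<Rightarrow> real option" where
  "power_opt a b =
     (if a > 0 then Some (a powr b)
      else if a = 0 then (if b > 0 then Some 0 else if b = 0 then Some 1 else None)
      else if b \<in> \<int> then Some (a powi \<lfloor>b\<rfloor>)
      else None)"

primrec eval :: "'v subst \<Rightarrow> 'v aexp \<Rightarrow> real option" where
  "eval \<sigma> (Var v) = map_option real_of_int (\<sigma> v)"
| "eval \<sigma> (Num r) = Some r"
| "eval \<sigma> (Add a b) = lift_opt (\<lambda>x y. Some (x + y)) (eval \<sigma> a) (eval \<sigma> b)"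
| "eval \<sigma> (Sub a b) = lift_opt (\<lambda>x y. Some (x - y)) (eval \<sigma> a) (eval \<sigma> b)"
| "eval \<sigma> (Mul a b) = lift_opt (\<lambda>x y. Some (x * y)) (eval \<sigma> a) (eval \<sigma> b)"
| "eval \<sigma> (Div a b) =
     lift_opt (\<lambda>x y. if y = 0 then None else Some (x / y)) (eval \<sigma> a) (eval \<sigma> b)"
| "eval \<sigma> (Pow a b) = lift_opt power_opt (eval \<sigma> a) (eval \<sigma> b)"

primrec holds :: "'v subst \<Rightarrow> 'v ineq \<Rightarrow> bool" where
  "holds \<sigma> (Less a b) \<longleftrightarrow> (\<exists>x y. eval \<sigma> a = Some x \<and> eval \<sigma> b = Some y \<and> x < y)"
| "holds \<sigma> (LessEq a b) \<longleftrightarrow> (\<exists>x y. eval \<sigma> a = Some x \<and> eval \<sigma> b = Some y \<and> x \<le> y)"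
| "holds \<sigma> (Greater a b) \<longleftrightarrow> (\<exists>x y. eval \<sigma> a = Some x \<and> eval \<sigma> b = Some y \<and> x > y)"
| "holds \<sigma> (GreaterEq a b) \<longleftrightarrow> (\<exists>x y. eval \<sigma> a = Some x \<and> eval \<sigma> b = Some y \<and> x \<ge> y)"

definition models :: "'v list \<Rightarrow> 'v subst \<Rightarrow> ('f, 'v) rule \<Rightarrow> bool" where
  "models xs \<sigma> \<alpha> \<longleftrightarrow> rule_vars xs \<alpha> \<subseteq> dom \<sigma> \<and> (\<forall>q\<in>set (guard \<alpha>). holds \<sigma> q)"

definition integer_program :: "'f set \<Rightarrow> 'f \<Rightarrow> 'v list \<Rightarrow> ('f, 'v) program \<Rightarrow> bool" where
  "integer_program Sig f0 xs P \<longleftrightarrow> finite P \<and>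
     (\<forall>\<alpha>\<in>P. lhs \<alpha> \<in> Sig \<and>
        (\<forall>(g, ts)\<in>#rhs \<alpha>. g \<in> Sig \<and> g \<noteq> f0 \<and> length ts = length xs))"

definition well_formed_rule :: "'v list \<Rightarrow> ('f, 'v) rule \<Rightarrow> bool" where
  "well_formed_rule xs \<alpha> \<longleftrightarrow>
     (\<forall>\<sigma>. models xs \<sigma> \<alpha> \<longrightarrow>
        (\<forall>(g, ts)\<in>#rhs \<alpha>. \<forall>t\<in>set ts. \<exists>z::int. eval \<sigma> t = Some (real_of_int z)))"

definition well_formed :: "'v list \<Rightarrow> ('f, 'v) program \<Rightarrow> bool" where
  "well_formed xs P \<longleftrightarrow> (\<forall>\<alpha>\<in>P. well_formed_rule xs \<alpha>)"

text \<open>\<open>instance_of \<sigma> Q R\<close>: the instance of the multiset of terms \<open>Q\<close> under \<open>\<sigma>\<close> equals,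
  modulo arithmetic, the configuration \<open>R\<close>.  In particular all arguments evaluate to integers.\<close>

definition instance_of :: "'v subst \<Rightarrow> ('f, 'v) trm multiset \<Rightarrow> 'f config \<Rightarrow> bool" where
  "instance_of \<sigma> Q R \<longleftrightarrow>
     image_mset (\<lambda>(g, ts). (g, map (eval \<sigma>) ts)) Q =
     image_mset (\<lambda>(g, ns). (g, map (\<lambda>n. Some (real_of_int n)) ns)) R"

definition step :: "'v list \<Rightarrow> ('f, 'v) program \<Rightarrow> 'f config \<Rightarrow> real \<Rightarrow> 'f config \<Rightarrow> bool" where
  "step xs P S k T \<longleftrightarrow>
     (\<exists>ns. \<exists>\<alpha>\<in>P. \<exists>\<sigma> R.
        (lhs \<alpha>, ns) \<in># S \<and> map \<sigma> xs = map Some ns \<and> models xs \<sigma> \<alpha> \<and>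
        eval \<sigma> (cost \<alpha>) = Some k \<and> instance_of \<sigma> (rhs \<alpha>) R \<and>
        T = (S - {#(lhs \<alpha>, ns)#}) + R)"

inductive steps :: "'v list \<Rightarrow> ('f, 'v) program \<Rightarrow> 'f config \<Rightarrow> real \<Rightarrow> 'f config \<Rightarrow> bool"
  for xs P where
  refl: "steps xs P S 0 S"
| step: "step xs P S k T \<Longrightarrow> steps xs P T l U \<Longrightarrow> steps xs P S (k + l) U"

definition dh :: "'v list \<Rightarrow> ('f, 'v) program \<Rightarrow> 'f config \<Rightarrow> ereal" where
  "dh xs P S = Sup {ereal k | k T. steps xs P S k T}"

definition rc :: "'f \<Rightarrow> 'v list \<Rightarrow> ('f, 'v) program \<Rightarrow> nat \<Rightarrow> ereal" where
  "rc f0 xs P n =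
     Sup {dh xs P {#(f0, ns)#} | ns. length ns = length xs \<and> (\<Sum>m\<leftarrow>ns. \<bar>m\<bar>) \<le> int n}"

definition processor ::
  "'f set \<Rightarrow> 'f \<Rightarrow> 'v list \<Rightarrow> (('f, 'v) program \<Rightarrow> ('f, 'v) program option) \<Rightarrow> bool" where
  "processor Sig f0 xs proc \<longleftrightarrow>
     (\<forall>P P'. proc P = Some P' \<longrightarrow> integer_program Sig f0 xs P \<and> integer_program Sig f0 xs P')"

definition sound ::
  "'f \<Rightarrow> 'v list \<Rightarrow> (('f, 'v) program \<Rightarrow> ('f, 'v) program option) \<Rightarrow> bool" where
  "sound f0 xs proc \<longleftrightarrow>
     (\<forall>P P'. proc P = Some P' \<longrightarrow> (\<forall>n::nat. rc f0 xs P n \<ge> rc f0 xs P' n))"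

definition partial_deletion ::
  "'f set \<Rightarrow> 'f \<Rightarrow> 'v list \<Rightarrow> ('f, 'v) program \<Rightarrow> ('f, 'v) program \<Rightarrow> bool" where
  "partial_deletion Sig f0 xs P P' \<longleftrightarrow>
     integer_program Sig f0 xs P \<and> well_formed xs P \<and>
     (\<exists>\<alpha>\<in>P. \<exists>\<alpha>'. lhs \<alpha>' = lhs \<alpha> \<and> cost \<alpha>' = cost \<alpha> \<and> guard \<alpha>' = guard \<alpha> \<and>
        rhs \<alpha>' \<subset># rhs \<alpha> \<and> P' = P \<union> {\<alpha>'})"

end

theory Submission imports Defs begin

text \<open>Every step of the truncated rule is simulated by the original rule at the same cost, and the
  terms that are produced in addition never block a later step. The one subtlety is that the deleted
  terms may contain variables that occur nowhere else, so a substitution modelling the truncated rule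
  need not cover the original one; extending it to all variables repairs this without changing the
  value of any expression of the truncated rule. Well-formedness of the original rule then makes the
  additional terms evaluate to integers, so the simulating step exists.\<close>

definition terms_vars :: "('f, 'v) trm multiset \<Rightarrow> 'v set" where
  "terms_vars Q = (\<Union>(g, ts)\<in>set_mset Q. \<Union>t\<in>set ts. vars t)"

lemma eval_map_le:
  assumes "\<sigma> \<subseteq>\<^sub>m \<tau>" and "vars e \<subseteq> dom \<sigma>"
  shows "eval \<tau> e = eval \<sigma> e"
  using assms by (induction e) (auto simp: map_le_def)

lemma holds_map_le:
  assumes "\<sigma> \<subseteq>\<^sub>m \<tau>" and "ineq_vars q \<subseteq> dom \<sigma>"
  shows "holds \<tau> q \<longleftrightarrow> holds \<sigma> q"
  using assms by (cases q) (simp_all add: eval_map_le)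

lemma instance_of_map_le:
  assumes "\<sigma> \<subseteq>\<^sub>m \<tau>" and "terms_vars Q \<subseteq> dom \<sigma>"
  shows "instance_of \<tau> Q R \<longleftrightarrow> instance_of \<sigma> Q R"
proof -
  have "vars t \<subseteq> dom \<sigma>" if "(g, ts) \<in># Q" and "t \<in> set ts" for g ts t
    using assms(2) that unfolding terms_vars_def UN_subset_iff by (metis UN_subset_iff case_prod_conv)
  then have "image_mset (\<lambda>(g, ts). (g, map (eval \<tau>) ts)) Q =
        image_mset (\<lambda>(g, ts). (g, map (eval \<sigma>) ts)) Q"
    by (intro image_mset_cong) (auto simp: eval_map_le[OF assms(1)])
  then show ?thesis
    unfolding instance_of_def by simp
qed

lemma models_dom:
  assumes "models xs \<sigma> \<alpha>"
  shows "set xs \<subseteq> dom \<sigma>" and "vars (cost \<alpha>) \<subseteq> dom \<sigma>" and "terms_vars (rhs \<alpha>) \<subseteq> dom \<sigma>"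
    and "q \<in> set (guard \<alpha>) \<Longrightarrow> ineq_vars q \<subseteq> dom \<sigma>"
  using assms unfolding models_def rule_vars_def terms_vars_def by auto

lemma models_extension:
  assumes "models xs \<sigma> \<beta>" and "guard \<alpha> = guard \<beta>"
  obtains \<tau> where "\<sigma> \<subseteq>\<^sub>m \<tau>" and "models xs \<tau> \<alpha>"
proof
  let ?\<tau> = "(\<lambda>_. Some 0) ++ \<sigma>"
  show le: "\<sigma> \<subseteq>\<^sub>m ?\<tau>" by simp
  have "holds ?\<tau> q" if "q \<in> set (guard \<alpha>)" for q
    using that assms holds_map_le[OF le models_dom(4)[OF assms(1)]] by (simp add: models_def)
  then show "models xs ?\<tau> \<alpha>"
    unfolding models_def by auto
qed

lemma instance_of_union_iff:
  "instance_of \<sigma> (Q + Q') S \<longleftrightarrow>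
     (\<exists>R R'. S = R + R' \<and> instance_of \<sigma> Q R \<and> instance_of \<sigma> Q' R')"
proof
  assume "instance_of \<sigma> (Q + Q') S"
  then show "\<exists>R R'. S = R + R' \<and> instance_of \<sigma> Q R \<and> instance_of \<sigma> Q' R'"
    unfolding instance_of_def image_mset_union by (blast dest: image_mset_eq_plusD[OF sym])
next
  assume "\<exists>R R'. S = R + R' \<and> instance_of \<sigma> Q R \<and> instance_of \<sigma> Q' R'"
  then show "instance_of \<sigma> (Q + Q') S"
    unfolding instance_of_def by auto
qed

lemma instance_of_exists_iff:
  "(\<exists>R. instance_of \<sigma> Q R) \<longleftrightarrow>
     (\<forall>(g, ts)\<in>#Q. \<forall>t\<in>set ts. \<exists>z::int. eval \<sigma> t = Some (real_of_int z))"
proof (intro iffI ballI, clarify)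
  fix R g ts t
  assume "instance_of \<sigma> Q R" and "(g, ts) \<in># Q" and "t \<in> set ts"
  then have "(g, map (eval \<sigma>) ts) \<in>#
      image_mset (\<lambda>(g, ns). (g, map (\<lambda>n. Some (real_of_int n)) ns)) R"
    unfolding instance_of_def by (metis (mono_tags, lifting) case_prod_conv imageI set_image_mset)
  then obtain ns where "map (eval \<sigma>) ts = map (\<lambda>n. Some (real_of_int n)) ns"
    by auto
  then have "eval \<sigma> t \<in> (\<lambda>n. Some (real_of_int n)) ` set ns"
    using \<open>t \<in> set ts\<close> by (metis imageI list.set_map)
  then show "\<exists>z::int. eval \<sigma> t = Some (real_of_int z)" by blast
next
  assume integral: "\<forall>(g, ts)\<in>#Q. \<forall>t\<in>set ts. \<exists>z::int. eval \<sigma> t = Some (real_of_int z)"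
  have "instance_of \<sigma> Q (image_mset (\<lambda>(g, ts). (g, map (\<lambda>t. \<lfloor>the (eval \<sigma> t)\<rfloor>) ts)) Q)"
    unfolding instance_of_def multiset.map_comp
    by (rule image_mset_cong) (use integral in fastforce)
  then show "\<exists>R. instance_of \<sigma> Q R" ..
qed

lemma well_formed_rule_iff_instance:
  "well_formed_rule xs \<alpha> \<longleftrightarrow> (\<forall>\<sigma>. models xs \<sigma> \<alpha> \<longrightarrow> (\<exists>R. instance_of \<sigma> (rhs \<alpha>) R))"
  unfolding well_formed_rule_def instance_of_exists_iff ..

definition rule_step ::
  "'v list \<Rightarrow> ('f, 'v) rule \<Rightarrow> 'f config \<Rightarrow> real \<Rightarrow> 'f config \<Rightarrow> bool" where
  "rule_step xs \<alpha> S k T \<longleftrightarrow>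
     (\<exists>ns \<sigma> R. (lhs \<alpha>, ns) \<in># S \<and> map \<sigma> xs = map Some ns \<and> models xs \<sigma> \<alpha> \<and>
        eval \<sigma> (cost \<alpha>) = Some k \<and> instance_of \<sigma> (rhs \<alpha>) R \<and>
        T = (S - {#(lhs \<alpha>, ns)#}) + R)"

lemma step_iff_rule_step: "step xs P S k T \<longleftrightarrow> (\<exists>\<alpha>\<in>P. rule_step xs \<alpha> S k T)"
  unfolding step_def rule_step_def by blast

definition truncation_of :: "('f, 'v) rule \<Rightarrow> ('f, 'v) rule \<Rightarrow> bool" where
  "truncation_of \<beta> \<alpha> \<longleftrightarrow>
     lhs \<beta> = lhs \<alpha> \<and> cost \<beta> = cost \<alpha> \<and> guard \<beta> = guard \<alpha> \<and> rhs \<beta> \<subseteq># rhs \<alpha>"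

lemma truncation_of_refl: "truncation_of \<alpha> \<alpha>"
  by (simp add: truncation_of_def)

lemma truncation_of_models_extension:
  assumes "truncation_of \<beta> \<alpha>" and wf: "well_formed_rule xs \<alpha>" and \<sigma>: "models xs \<sigma> \<beta>"
  obtains \<tau> R D where "\<sigma> \<subseteq>\<^sub>m \<tau>" and "models xs \<tau> \<alpha>"
    and "instance_of \<tau> (rhs \<beta>) R" and "instance_of \<tau> (rhs \<alpha> - rhs \<beta>) D"
proof -
  have "guard \<alpha> = guard \<beta>" and split: "rhs \<beta> + (rhs \<alpha> - rhs \<beta>) = rhs \<alpha>"
    using assms(1) by (simp_all add: truncation_of_def)
  then obtain \<tau> where \<tau>: "\<sigma> \<subseteq>\<^sub>m \<tau>" "models xs \<tau> \<alpha>"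
    using models_extension[OF \<sigma>] by blast
  then obtain S where "instance_of \<tau> (rhs \<beta> + (rhs \<alpha> - rhs \<beta>)) S"
    using wf unfolding well_formed_rule_iff_instance split by blast
  then show ?thesis
    using that[OF \<tau>] unfolding instance_of_union_iff by blast
qed

lemma well_formed_rule_truncation:
  assumes "truncation_of \<beta> \<alpha>" and "well_formed_rule xs \<alpha>"
  shows "well_formed_rule xs \<beta>"
  unfolding well_formed_rule_iff_instance
proof (intro allI impI)
  fix \<sigma>
  assume \<sigma>: "models xs \<sigma> \<beta>"
  obtain \<tau> R where "\<sigma> \<subseteq>\<^sub>m \<tau>" and "instance_of \<tau> (rhs \<beta>) R"
    using truncation_of_models_extension[OF assms \<sigma>] .
  then show "\<exists>R. instance_of \<sigma> (rhs \<beta>) R"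
    using instance_of_map_le models_dom(3)[OF \<sigma>] by blast
qed

lemma rule_step_truncation:
  assumes trunc: "truncation_of \<beta> \<alpha>" and wf: "well_formed_rule xs \<alpha>"
    and step: "rule_step xs \<beta> S k T" and sub: "S \<subseteq># S'"
  obtains T' where "rule_step xs \<alpha> S' k T'" and "T \<subseteq># T'"
proof -
  have eq: "lhs \<beta> = lhs \<alpha>" "cost \<beta> = cost \<alpha>" and split: "rhs \<beta> + (rhs \<alpha> - rhs \<beta>) = rhs \<alpha>"
    using trunc by (simp_all add: truncation_of_def)
  obtain ns \<sigma> R where redex: "(lhs \<alpha>, ns) \<in># S" and args: "map \<sigma> xs = map Some ns"
      and \<sigma>: "models xs \<sigma> \<beta>" and cost: "eval \<sigma> (cost \<beta>) = Some k"
      and R: "instance_of \<sigma> (rhs \<beta>) R" and T: "T = S - {#(lhs \<alpha>, ns)#} + R"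
    using step unfolding rule_step_def eq by blast
  obtain \<tau> D where le: "\<sigma> \<subseteq>\<^sub>m \<tau>" and \<tau>: "models xs \<tau> \<alpha>"
      and D: "instance_of \<tau> (rhs \<alpha> - rhs \<beta>) D"
    using truncation_of_models_extension[OF trunc wf \<sigma>] .
  have "\<tau> x = \<sigma> x" if "x \<in> set xs" for x
    using le models_dom(1)[OF \<sigma>] that by (metis map_le_def subsetD)
  then have "map \<tau> xs = map Some ns"
    unfolding args[symmetric] by simp
  moreover have "eval \<tau> (cost \<alpha>) = Some k"
    using cost eval_map_le[OF le models_dom(2)[OF \<sigma>]] eq by simp
  moreover have "instance_of \<tau> (rhs \<beta> + (rhs \<alpha> - rhs \<beta>)) (R + D)"
    using R D instance_of_map_le[OF le models_dom(3)[OF \<sigma>]]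
    unfolding instance_of_union_iff by blast
  ultimately have "rule_step xs \<alpha> S' k (S' - {#(lhs \<alpha>, ns)#} + (R + D))"
    unfolding rule_step_def split using mset_subset_eqD[OF sub redex] \<tau> by blast
  moreover have "T \<subseteq># S' - {#(lhs \<alpha>, ns)#} + (R + D)"
    unfolding T using sub by (simp add: subseteq_mset_def diff_le_mono trans_le_add1)
  ultimately show ?thesis by (rule that)
qed

definition simulates :: "'v list \<Rightarrow> ('f, 'v) program \<Rightarrow> ('f, 'v) program \<Rightarrow> bool" where
  "simulates xs P P' \<longleftrightarrow>
     (\<forall>S k T S'. step xs P' S k T \<longrightarrow> S \<subseteq># S' \<longrightarrow> (\<exists>T'. step xs P S' k T' \<and> T \<subseteq># T'))"

lemma steps_simulation:
  assumes "simulates xs P P'" and "steps xs P' S k T" and "S \<subseteq># S'"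
  shows "\<exists>T'. steps xs P S' k T' \<and> T \<subseteq># T'"
  using assms(2,3)
proof (induction arbitrary: S' rule: steps.induct)
  case (refl S)
  then show ?case using steps.refl by blast
next
  case (step S k T l U)
  obtain T' where "step xs P S' k T'" and "T \<subseteq># T'"
    using assms(1) step.hyps(1) step.prems unfolding simulates_def by blast
  then show ?case
    using step.IH steps.step by blast
qed

lemma simulates_dh_le:
  assumes "simulates xs P P'" and "S \<subseteq># S'"
  shows "dh xs P' S \<le> dh xs P S'"
  unfolding dh_def by (rule Sup_subset_mono) (use steps_simulation[OF assms(1) _ assms(2)] in blast)

lemma simulates_rc_le:
  assumes "simulates xs P P'"
  shows "rc f0 xs P' n \<le> rc f0 xs P n"
  unfolding rc_def using simulates_dh_le[OF assms subset_mset.order_refl] by (intro Sup_mono) blast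

definition program_truncation_of :: "('f, 'v) program \<Rightarrow> ('f, 'v) program \<Rightarrow> bool" where
  "program_truncation_of P' P \<longleftrightarrow> (\<forall>\<beta>\<in>P'. \<exists>\<alpha>\<in>P. truncation_of \<beta> \<alpha>)"

lemma integer_program_truncation:
  assumes "program_truncation_of P' P" and "finite P'" and P: "integer_program Sig f0 xs P"
  shows "integer_program Sig f0 xs P'"
  unfolding integer_program_def
proof (intro conjI assms(2) ballI)
  fix \<beta>
  assume "\<beta> \<in> P'"
  then obtain \<alpha> where "\<alpha> \<in> P" and \<beta>: "lhs \<beta> = lhs \<alpha>" "rhs \<beta> \<subseteq># rhs \<alpha>"
    using assms(1) unfolding program_truncation_of_def truncation_of_def by blast
  then show "lhs \<beta> \<in> Sig"
    using P unfolding integer_program_def by auto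
  show "case p of (g, ts) \<Rightarrow> g \<in> Sig \<and> g \<noteq> f0 \<and> length ts = length xs" if "p \<in># rhs \<beta>" for p
    using P \<open>\<alpha> \<in> P\<close> mset_subset_eqD[OF \<beta>(2) that] unfolding integer_program_def by blast
qed

lemma well_formed_truncation:
  assumes "program_truncation_of P' P" and "well_formed xs P"
  shows "well_formed xs P'"
  using assms well_formed_rule_truncation
  unfolding program_truncation_of_def well_formed_def by blast

lemma simulates_truncation:
  assumes trunc: "program_truncation_of P' P" and wf: "well_formed xs P"
  shows "simulates xs P P'"
  unfolding simulates_def
proof (intro allI impI)
  fix S S' T k
  assume "step xs P' S k T" and "S \<subseteq># S'"
  then obtain \<beta> where "\<beta> \<in> P'" and step: "rule_step xs \<beta> S k T"
    unfolding step_iff_rule_step by blast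
  then obtain \<alpha> where "\<alpha> \<in> P" and "truncation_of \<beta> \<alpha>"
    using trunc unfolding program_truncation_of_def by blast
  moreover have "well_formed_rule xs \<alpha>"
    using wf \<open>\<alpha> \<in> P\<close> unfolding well_formed_def by blast
  ultimately show "\<exists>T'. step xs P S' k T' \<and> T \<subseteq># T'"
    using rule_step_truncation[OF _ _ step \<open>S \<subseteq># S'\<close>] unfolding step_iff_rule_step by metis
qed

lemma partial_deletionD:
  assumes "partial_deletion Sig f0 xs P P'"
  shows "integer_program Sig f0 xs P" and "well_formed xs P" and "program_truncation_of P' P"
    and "finite P'"
proof -
  obtain \<alpha> \<alpha>' where "\<alpha> \<in> P" and "truncation_of \<alpha>' \<alpha>" and "P' = insert \<alpha>' P"
    using assms unfolding partial_deletion_def truncation_of_def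
    by (auto simp: subset_mset.less_le)
  then show "program_truncation_of P' P"
    unfolding program_truncation_of_def using truncation_of_refl by blast
  show "integer_program Sig f0 xs P" and "well_formed xs P" and "finite P'"
    using assms unfolding partial_deletion_def integer_program_def by auto
qed

theorem theorem4p7:
  fixes Sig :: "'f set" and f0 :: 'f and xs :: "'v list"
  assumes "finite Sig" and "f0 \<in> Sig" and "distinct xs"
  shows "(\<forall>P P'. partial_deletion Sig f0 xs P P' \<longrightarrow>
            integer_program Sig f0 xs P' \<and> well_formed xs P') \<and>
         (\<forall>proc. (\<forall>P P'. proc P = Some P' \<longrightarrow> partial_deletion Sig f0 xs P P') \<longrightarrow>
            processor Sig f0 xs proc \<and> sound f0 xs proc)"
proof -
  have preserved: "integer_program Sig f0 xs P' \<and> well_formed xs P'"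
    if "partial_deletion Sig f0 xs P P'" for P P' :: "('f, 'v) program"
    using partial_deletionD[OF that] integer_program_truncation well_formed_truncation
    by metis
  moreover have "rc f0 xs P' n \<le> rc f0 xs P n"
    if "partial_deletion Sig f0 xs P P'" for P P' :: "('f, 'v) program" and n
    using partial_deletionD(2,3)[OF that] by (intro simulates_rc_le simulates_truncation)
  ultimately have "processor Sig f0 xs proc \<and> sound f0 xs proc"
    if "\<forall>P P'. proc P = Some P' \<longrightarrow> partial_deletion Sig f0 xs P P'" for proc
    unfolding processor_def sound_def using that partial_deletionD(1) by metis
  with preserved show ?thesis by blast
qed

end
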